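(* Let $\mathcal A$ be a finite set of $m\ge2$ alternatives, $n\ge2$, $0<\varphi<1$, and consider Mallows' model with dispersion $\varphi$ and $n$ i.i.d. rankings. Let $a\in\mathcal A$, $H_0=L_{a\succ\text{others}}$, and $H_1\subseteq\mathcal L(\mathcal A)\setminus H_0$. Then there exists a level-$\alpha$ UMP test for $H_0$ vs. $H_1$ for all $0<\alpha<1$ if and only if there exists $B\subseteq\mathcal A\setminus\{a\}$ such that $H_1\subseteq L_{B\succ a}$. Moreover, when $H_1\subseteq L_{B\succ a}$, for every $0<\alpha<1$ the following test is a level-$\alpha$ UMP test for $H_0$ vs. $H_1$: for every $n$-profile $P_n$, $$f_{\alpha,a,B}(P_n)=\begin{cases}1&\text{if }w_{P_n}(B\succ a)>K_\alpha\\ 0&\text{if }w_{P_n}(B\succ a)<K_\alpha\\ \Gamma_\alpha&\text{if }w_{P_n}(B\succ a)=K_\alpha,\end{cases}$$ where $K_\alpha\in\mathbb R$ and $\Gamma_\alpha\in[0,1]$ are chosen such that the size of $f_{\alpha,a,B}$ is $\alpha$.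
   Context: $\mathcal L(\mathcal A)$ is the set of all linear orders (rankings) over $\mathcal A$; $b\succ_V c$ means $b$ is preferred to $c$ in $V$. $L_{a\succ\text{others}}=\{V\in\mathcal L(\mathcal A): a\succ_V b\text{ for all }b\ne a\}$. For $B\subseteq\mathcal A\setminus\{a\}$, $L_{B\succ a}$ is the set of all rankings in which the set of alternatives ranked above $a$ is exactly $B$. The Kendall-tau distance $\mathrm{KT}(V,W)$ is the number of unordered pairs of alternatives on which $V$ and $W$ disagree. Mallows' model with fixed dispersion $\varphi$: sample space $\mathcal L(\mathcal A)^n$, parameter space $\mathcal L(\mathcal A)$; given parameter $W$, the $n$ rankings are i.i.d. with $\pi_W(V)=\frac1Z\varphi^{\mathrm{KT}(V,W)}$, $Z$ the normalization factor. An $n$-profile $P$ is an element of $\mathcal L(\mathcal A)^n$; $P(b\succ c)$ is the number of votes in $P$ in which $b$ is preferred to $c$; $w_P(b\succ c)=P(b\succ c)-P(c\succ b)$; $w_P(B\succ a)=\sum_{b\in B}w_P(b\succ a)$. Testing: for disjoint sets of parameters $H_0,H_1$, a (randomized) test is a function $f$ from the sample space to $[0,1]$ ($f(P)$ is the probability of rejecting $H_0$). $\mathrm{Size}(f,h_0)=E_{P\sim\pi_{h_0}}f(P)$, $\mathrm{Size}(f)=\sup_{h_0\in H_0}\mathrm{Size}(f,h_0)$, and $\mathrm{Power}(f,h_1)=E_{P\sim\pi_{h_1}}f(P)$ for $h_1\in H_1$. A level-$\alpha$ uniformly most powerful (UMP) test for $H_0$ vs. $H_1$ is a test $f$ with $\mathrm{Size}(f)=\alpha$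 such that for every $h_1\in H_1$ and every test $g$ with $\mathrm{Size}(g)\le\alpha$, $\mathrm{Power}(f,h_1)\ge\mathrm{Power}(g,h_1)$. *)

theory Defs
  imports "HOL-Probability.Probability"
begin

section \<open>Rankings\<close>

text \<open>
  A ranking is a reflexive linear order on the set \<open>A\<close> of alternatives, with \<open>(b, c) \<in> V\<close> meaning
  that \<open>b\<close> is ranked at least as high as \<open>c\<close>. Since \<^const>\<open>linear_order_on\<close> includes
  \<open>V \<subseteq> A \<times> A\<close>, there are finitely many rankings when \<open>A\<close> is finite.
\<close>

definition rankings :: "'a set \<Rightarrow> 'a rel set" where
  "rankings A = {V. linear_order_on A V}"

definition prefers :: "'a \<Rightarrow> 'a rel \<Rightarrow> 'a \<Rightarrow> bool" ("(_ \<succ>\<^bsub>_\<^esub> _)" [51, 0, 51] 50) where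
  "b \<succ>\<^bsub>V\<^esub> c \<longleftrightarrow> b \<noteq> c \<and> (b, c) \<in> V"

definition L_top :: "'a set \<Rightarrow> 'a \<Rightarrow> 'a rel set" where
  "L_top A a = {V \<in> rankings A. \<forall>b\<in>A. b \<noteq> a \<longrightarrow> a \<succ>\<^bsub>V\<^esub> b}"

definition L_above :: "'a set \<Rightarrow> 'a set \<Rightarrow> 'a \<Rightarrow> 'a rel set" where
  "L_above A B a = {V \<in> rankings A. {b \<in> A. b \<succ>\<^bsub>V\<^esub> a} = B}"

text \<open>Unordered pairs are counted as two-element sets, so each disagreement counts once.\<close>

definition KT :: "'a rel \<Rightarrow> 'a rel \<Rightarrow> nat" where
  "KT V W = card {{b, c} | b c. b \<succ>\<^bsub>V\<^esub> c \<and> c \<succ>\<^bsub>W\<^esub> b}"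


section \<open>Profiles\<close>

definition profiles :: "'a set \<Rightarrow> nat \<Rightarrow> 'a rel list set" where
  "profiles A n = {P \<in> lists (rankings A). length P = n}"

definition votes :: "'a rel list \<Rightarrow> 'a \<Rightarrow> 'a \<Rightarrow> nat" where
  "votes P b c = card {i. i < length P \<and> b \<succ>\<^bsub>P ! i\<^esub> c}"

definition margin :: "'a rel list \<Rightarrow> 'a \<Rightarrow> 'a \<Rightarrow> int" where
  "margin P b c = int (votes P b c) - int (votes P c b)"

definition margin_set :: "'a rel list \<Rightarrow> 'a set \<Rightarrow> 'a \<Rightarrow> int" where
  "margin_set P B a = (\<Sum>b\<in>B. margin P b a)"


section \<open>Mallows' model\<close>

definition mallows_Z :: "'a set \<Rightarrow> real \<Rightarrow> 'a rel \<Rightarrow> real" where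
  "mallows_Z A \<phi> W = (\<Sum>V\<in>rankings A. \<phi> ^ KT V W)"

definition mallows :: "'a set \<Rightarrow> real \<Rightarrow> 'a rel \<Rightarrow> 'a rel pmf" where
  "mallows A \<phi> W =
    embed_pmf (\<lambda>V. if V \<in> rankings A then \<phi> ^ KT V W / mallows_Z A \<phi> W else 0)"

definition mallows_model :: "'a set \<Rightarrow> nat \<Rightarrow> real \<Rightarrow> 'a rel \<Rightarrow> 'a rel list pmf" where
  "mallows_model A n \<phi> W = replicate_pmf n (mallows A \<phi> W)"

text \<open>
  The function passed to \<^const>\<open>embed_pmf\<close> is indeed a probability mass function, so
  \<open>mallows A \<phi> W\<close> has the intended point masses.
\<close>

lemma finite_rankings: "finite A \<Longrightarrow> finite (rankings A)"
  by (rule finite_subset[of _ "Pow (A \<times> A)"])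
    (auto simp: rankings_def linear_order_on_def dest!: partial_order_onD(4))

lemma rankings_nonempty: "rankings A \<noteq> {}"
  using well_order_on[of A] by (auto simp: rankings_def well_order_on_def)

lemma mallows_Z_pos:
  assumes "finite A" "0 < \<phi>"
  shows "0 < mallows_Z A \<phi> W"
  unfolding mallows_Z_def
  using assms by (intro sum_pos finite_rankings rankings_nonempty) auto

lemma pmf_mallows:
  assumes "finite A" "0 < \<phi>"
  shows "pmf (mallows A \<phi> W) V =
    (if V \<in> rankings A then \<phi> ^ KT V W / mallows_Z A \<phi> W else 0)"
  unfolding mallows_def
proof (rule pmf_embed_pmf)
  let ?f = "\<lambda>V. if V \<in> rankings A then \<phi> ^ KT V W / mallows_Z A \<phi> W else 0"
  have Z: "0 < mallows_Z A \<phi> W"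
    using assms by (rule mallows_Z_pos)
  show nonneg: "0 \<le> ?f V" for V
    using assms Z by auto
  have "(\<integral>\<^sup>+V. ennreal (?f V) \<partial>count_space UNIV) = (\<Sum>V\<in>rankings A. ennreal (?f V))"
    by (rule nn_integral_count_space'[OF finite_rankings[OF assms(1)]]) auto
  also have "\<dots> = ennreal (\<Sum>V\<in>rankings A. ?f V)"
    by (rule sum_ennreal) (rule nonneg)
  also have "(\<Sum>V\<in>rankings A. ?f V) = (\<Sum>V\<in>rankings A. \<phi> ^ KT V W) / mallows_Z A \<phi> W"
    by (simp add: sum_divide_distrib)
  also have "\<dots> = 1"
    using Z by (simp add: mallows_Z_def)
  finally show "(\<integral>\<^sup>+V. ennreal (?f V) \<partial>count_space UNIV) = 1"
    by simp
qed

lemma set_pmf_mallows_model: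
  assumes "finite A" "0 < \<phi>"
  shows "set_pmf (mallows_model A n \<phi> W) = profiles A n"
proof -
  have "\<phi> ^ KT V W / mallows_Z A \<phi> W \<noteq> 0" for V
    using assms mallows_Z_pos[OF assms, of W] by simp
  hence "set_pmf (mallows A \<phi> W) = rankings A"
    using assms by (auto simp: set_pmf_eq pmf_mallows)
  thus ?thesis
    by (simp add: mallows_model_def set_replicate_pmf profiles_def)
qed


section \<open>Hypothesis testing\<close>

text \<open>
  A statistical model \<open>M\<close> assigns to every parameter a distribution on the sample space \<open>S\<close>.
  In \<open>size_test\<close> the supremum is a supremum of reals: it is meant for nonempty \<open>H0\<close> and tests
  with values in \<open>[0, 1]\<close>.
\<close>

definition is_test :: "'s set \<Rightarrow> ('s \<Rightarrow> real) \<Rightarrow> bool" where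
  "is_test S f \<longleftrightarrow> f \<in> S \<rightarrow> {0..1}"

definition size_at :: "('p \<Rightarrow> 's pmf) \<Rightarrow> ('s \<Rightarrow> real) \<Rightarrow> 'p \<Rightarrow> real" where
  "size_at M f h0 = measure_pmf.expectation (M h0) f"

definition size_test :: "('p \<Rightarrow> 's pmf) \<Rightarrow> 'p set \<Rightarrow> ('s \<Rightarrow> real) \<Rightarrow> real" where
  "size_test M H0 f = (SUP h0\<in>H0. size_at M f h0)"

definition power_at :: "('p \<Rightarrow> 's pmf) \<Rightarrow> ('s \<Rightarrow> real) \<Rightarrow> 'p \<Rightarrow> real" where
  "power_at M f h1 = measure_pmf.expectation (M h1) f"

definition is_UMP ::
  "'s set \<Rightarrow> ('p \<Rightarrow> 's pmf) \<Rightarrow> real \<Rightarrow> 'p set \<Rightarrow> 'p set \<Rightarrow> ('s \<Rightarrow> real) \<Rightarrow> bool" where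
  "is_UMP S M \<alpha> H0 H1 f \<longleftrightarrow>
    is_test S f \<and> size_test M H0 f = \<alpha> \<and>
    (\<forall>h1\<in>H1. \<forall>g. is_test S g \<and> size_test M H0 g \<le> \<alpha> \<longrightarrow> power_at M g h1 \<le> power_at M f h1)"

text \<open>The threshold test with threshold \<open>K\<close> and rejection probability \<open>\<Gamma>\<close> on the threshold.\<close>

definition threshold_test :: "'a \<Rightarrow> 'a set \<Rightarrow> real \<Rightarrow> real \<Rightarrow> 'a rel list \<Rightarrow> real" where
  "threshold_test a B K \<Gamma> P =
    (if real_of_int (margin_set P B a) > K then 1
     else if real_of_int (margin_set P B a) < K then 0
     else \<Gamma>)"

end

theory Submission
  imports Defs
begin

text \<open>
  Let \<open>w\<close> be the margin of \<open>B\<close> over \<open>a\<close>. A ranking \<open>W\<close> with exactly \<open>B\<close> above \<open>a\<close> and the null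
  hypothesis obtained from it by raising \<open>a\<close> to the top differ only in the pairs formed by \<open>a\<close> and
  the members of \<open>B\<close>. Each vote therefore contributes a factor \<open>\<phi>\<close> or \<open>1 / \<phi>\<close> for each such pair to
  their likelihood ratio, which is thus a constant times \<open>\<phi> powr (- w)\<close>, an increasing function of \<open>w\<close>
  (\<open>mallows_likelihood_ratio\<close>). By the Neyman-Pearson lemma a threshold test in \<open>w\<close> is most powerful
  for \<open>W\<close> against this single null hypothesis.

  To pass to the composite null hypothesis, this single one has to be least favourable for the
  threshold test. It ranks \<open>B\<close> immediately below \<open>a\<close>. Any other ranking with \<open>a\<close> on top is turned into
  it by adjacent transpositions that never move a member of \<open>B\<close> below a nonmember. By a symmetry
  argument each of them makes the margin of a single vote stochastically larger or leaves its
  distribution unchanged (\<open>mallows_swap_mono\<close>), and this carries over to the sum over independent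
  votes. Hence the size of a threshold test is attained at the raised ranking
  (\<open>size_threshold_test\<close>). As the test depends on \<open>B\<close> only, it is most powerful against all
  rankings in \<^term>\<open>L_above A B a\<close> simultaneously.

  Conversely, suppose that \<open>H1\<close> contains rankings with different sets \<open>B1\<close> and \<open>B2\<close> above \<open>a\<close>, with
  \<open>B2\<close> not contained in \<open>B1\<close>. A UMP test has to agree with a threshold test for each of the two sets
  away from the respective threshold, since the Neyman-Pearson lemma also gives uniqueness there.
  At the level where the test for \<open>B1\<close> rejects exactly the profiles with the largest margin, two
  explicit profiles show that this is impossible (\<open>no_UMP_if_not_subset\<close>).
\<close>

section \<open>Rankings and their rearrangements\<close>

lemma rankings_iff:
  "V \<in> rankings A \<longleftrightarrow>
    V \<subseteq> A \<times> A \<and> (\<forall>x\<in>A. (x, x) \<in> V) \<and>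
    (\<forall>x y z. (x, y) \<in> V \<longrightarrow> (y, z) \<in> V \<longrightarrow> (x, z) \<in> V) \<and>
    (\<forall>x y. (x, y) \<in> V \<longrightarrow> (y, x) \<in> V \<longrightarrow> x = y) \<and>
    (\<forall>x\<in>A. \<forall>y\<in>A. (x, y) \<in> V \<or> (y, x) \<in> V)"
proof -
  have "V \<in> rankings A \<longleftrightarrow>
      V \<subseteq> A \<times> A \<and> refl_on A V \<and> trans V \<and> antisym V \<and> total_on A V"
    by (simp add: rankings_def order_on_defs conj_assoc)
  also have "refl_on A V \<longleftrightarrow> (\<forall>x\<in>A. (x, x) \<in> V)"
    by (simp add: refl_on_def)
  also have "trans V \<longleftrightarrow> (\<forall>x y z. (x, y) \<in> V \<longrightarrow> (y, z) \<in> V \<longrightarrow> (x, z) \<in> V)"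
    by (simp only: trans_def)
  also have "antisym V \<longleftrightarrow> (\<forall>x y. (x, y) \<in> V \<longrightarrow> (y, x) \<in> V \<longrightarrow> x = y)"
    by (simp only: antisym_def)
  finally have unfolded: "V \<in> rankings A \<longleftrightarrow> V \<subseteq> A \<times> A \<and> (\<forall>x\<in>A. (x, x) \<in> V) \<and>
      (\<forall>x y z. (x, y) \<in> V \<longrightarrow> (y, z) \<in> V \<longrightarrow> (x, z) \<in> V) \<and>
      (\<forall>x y. (x, y) \<in> V \<longrightarrow> (y, x) \<in> V \<longrightarrow> x = y) \<and> total_on A V" .
  have "(\<forall>x\<in>A. (x, x) \<in> V) \<longrightarrow>
      total_on A V = (\<forall>x\<in>A. \<forall>y\<in>A. (x, y) \<in> V \<or> (y, x) \<in> V)"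
    unfolding total_on_def by metis
  then show ?thesis using unfolded by argo
qed

lemma prefers_in:
  assumes "V \<in> rankings A" "b \<succ>\<^bsub>V\<^esub> c"
  shows "b \<in> A" "c \<in> A" "b \<noteq> c"
  using assms unfolding rankings_iff prefers_def by blast+

lemma not_prefers_iff:
  assumes "V \<in> rankings A" "b \<in> A" "c \<in> A" "b \<noteq> c"
  shows "\<not> b \<succ>\<^bsub>V\<^esub> c \<longleftrightarrow> c \<succ>\<^bsub>V\<^esub> b"
  using assms unfolding rankings_iff prefers_def by blast+

lemma prefers_asym: "V \<in> rankings A \<Longrightarrow> b \<succ>\<^bsub>V\<^esub> c \<Longrightarrow> \<not> c \<succ>\<^bsub>V\<^esub> b"
  unfolding rankings_iff prefers_def by blast

lemma prefers_trans: "V \<in> rankings A \<Longrightarrow> b \<succ>\<^bsub>V\<^esub> c \<Longrightarrow> c \<succ>\<^bsub>V\<^esub> d \<Longrightarrow> b \<succ>\<^bsub>V\<^esub> d"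
  unfolding rankings_iff prefers_def by blast

lemma rankings_eqI:
  assumes "V \<in> rankings A" "W \<in> rankings A" "\<And>b c. b \<succ>\<^bsub>V\<^esub> c \<Longrightarrow> b \<succ>\<^bsub>W\<^esub> c"
  shows "V = W"
proof -
  have "(b, c) \<in> V \<longleftrightarrow> (b, c) \<in> W" for b c
  proof (cases "b \<in> A \<and> c \<in> A \<and> b \<noteq> c")
    case True
    then have "b \<succ>\<^bsub>V\<^esub> c \<longleftrightarrow> b \<succ>\<^bsub>W\<^esub> c"
      using assms(3) not_prefers_iff[OF assms(1), of b c] prefers_asym[OF assms(2), of b c] by blast
    with True show ?thesis by (simp add: prefers_def)
  next
    case False
    have "U \<subseteq> A \<times> A" "\<forall>x\<in>A. (x, x) \<in> U" if "U \<in> rankings A" for U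
      using that by (simp_all add: rankings_iff)
    then show ?thesis using False assms(1,2) by blast
  qed
  then show ?thesis by auto
qed

lemma L_top_subset_rankings: "L_top A a \<subseteq> rankings A"
  by (auto simp: L_top_def)

lemma L_top_prefers: "V \<in> L_top A a \<Longrightarrow> b \<in> A \<Longrightarrow> b \<noteq> a \<Longrightarrow> a \<succ>\<^bsub>V\<^esub> b"
  by (auto simp: L_top_def)

text \<open>
  Rankings with prescribed blocks of alternatives are needed at several places. They arise by sorting
  \<open>A\<close> by a numerical key, smallest first, and breaking ties as in a given ranking.
\<close>

definition sort_by :: "'a set \<Rightarrow> ('a \<Rightarrow> nat) \<Rightarrow> 'a rel \<Rightarrow> 'a rel" where
  "sort_by A key V =
    {(x, y). x \<in> A \<and> y \<in> A \<and> (key x < key y \<or> key x = key y \<and> (x, y) \<in> V)}"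

lemma sort_by_rankings:
  assumes "V \<in> rankings A"
  shows "sort_by A key V \<in> rankings A"
proof -
  have mem: "(x, y) \<in> sort_by A key V \<longleftrightarrow>
      x \<in> A \<and> y \<in> A \<and> (key x < key y \<or> key x = key y \<and> (x, y) \<in> V)" for x y
    by (simp add: sort_by_def)
  have V: "\<And>x. x \<in> A \<Longrightarrow> (x, x) \<in> V" "\<And>x y z. (x, y) \<in> V \<Longrightarrow> (y, z) \<in> V \<Longrightarrow> (x, z) \<in> V"
    "\<And>x y. (x, y) \<in> V \<Longrightarrow> (y, x) \<in> V \<Longrightarrow> x = y"
    "\<And>x y. x \<in> A \<Longrightarrow> y \<in> A \<Longrightarrow> (x, y) \<in> V \<or> (y, x) \<in> V"
    using assms unfolding rankings_iff by blast+
  show ?thesis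
    unfolding rankings_iff
  proof (intro conjI allI ballI impI)
    show "sort_by A key V \<subseteq> A \<times> A" by (auto simp: mem)
    show "(x, x) \<in> sort_by A key V" if "x \<in> A" for x using that V(1) by (simp add: mem)
    show "(x, z) \<in> sort_by A key V"
      if "(x, y) \<in> sort_by A key V" "(y, z) \<in> sort_by A key V" for x y z
      using that V(2)[of x y z] unfolding mem by fastforce
    show "x = y" if "(x, y) \<in> sort_by A key V" "(y, x) \<in> sort_by A key V" for x y
      using that V(3)[of x y] unfolding mem by fastforce
    show "(x, y) \<in> sort_by A key V \<or> (y, x) \<in> sort_by A key V" if "x \<in> A" "y \<in> A" for x y
      using that V(4)[of x y] unfolding mem by fastforce
  qed
qed

lemma prefers_sort_by:
  "b \<succ>\<^bsub>sort_by A key V\<^esub> c \<longleftrightarrow>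
    b \<in> A \<and> c \<in> A \<and> (key b < key c \<or> key b = key c \<and> b \<succ>\<^bsub>V\<^esub> c)"
  by (auto simp: prefers_def sort_by_def)

text \<open>Moving \<open>a\<close> to the top reverses exactly the comparisons of \<open>a\<close> with the alternatives above it.\<close>

definition raise :: "'a set \<Rightarrow> 'a \<Rightarrow> 'a rel \<Rightarrow> 'a rel" where
  "raise A a V = sort_by A (\<lambda>x. of_bool (x \<noteq> a)) V"

lemma raise_in_L_top: "V \<in> rankings A \<Longrightarrow> a \<in> A \<Longrightarrow> raise A a V \<in> L_top A a"
  by (auto simp: L_top_def raise_def sort_by_rankings prefers_sort_by)

lemma L_above_nonempty:
  assumes "B \<subseteq> A - {a}" "a \<in> A"
  obtains V where "V \<in> L_above A B a"
proof -
  obtain V where V: "V \<in> rankings A" using rankings_nonempty[of A] by auto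
  have "sort_by A (\<lambda>x. if x \<in> B then 0 else if x = a then 1 else 2) V \<in> L_above A B a"
    using assms V 
    using prefers_in(3)[OF V, of a a]
    by (auto simp: L_above_def prefers_sort_by sort_by_rankings split: if_splits)
  then show thesis by (rule that)
qed

text \<open>
  Everything above \<open>a\<close> precedes everything below \<open>a\<close>, and raising \<open>a\<close> does not change that. The raised
  ranking therefore consists of \<open>a\<close>, the block \<open>B\<close> and the remaining alternatives, in this order.
\<close>

lemma raise_block:
  assumes "V \<in> L_above A B a" "b \<in> B" "c \<in> A - B - {a}" "a \<in> A"
  shows "b \<succ>\<^bsub>raise A a V\<^esub> c"
proof -
  have V: "V \<in> rankings A" and B: "b \<in> A" "b \<succ>\<^bsub>V\<^esub> a" and "\<not> c \<succ>\<^bsub>V\<^esub> a"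
    using assms by (auto simp: L_above_def)
  then have "b \<succ>\<^bsub>V\<^esub> c"
    using assms(3,4) not_prefers_iff[OF V, of c a] prefers_trans[OF V, of b a c] by auto
  moreover have "b \<noteq> a" using B by (auto simp: prefers_def)
  ultimately show ?thesis using assms(3) B by (auto simp: raise_def prefers_sort_by)
qed

text \<open>
  An adjacent transposition is encoded as a renaming of alternatives. A renaming preserves the
  Kendall-tau distance when applied to both rankings, which allows votes and centres to be
  transposed together.
\<close>

definition swap_alts :: "'a \<Rightarrow> 'a \<Rightarrow> 'a rel \<Rightarrow> 'a rel" where
  "swap_alts x y V = inv_image V (Transposition.transpose x y)"

lemma swap_alts_swap_alts [simp]: "swap_alts x y (swap_alts x y V) = V"
  by (auto simp: swap_alts_def inv_image_def)

lemma prefers_swap_alts: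
  "b \<succ>\<^bsub>swap_alts x y V\<^esub> c \<longleftrightarrow> Transposition.transpose x y b \<succ>\<^bsub>V\<^esub> Transposition.transpose x y c"
  by (simp add: swap_alts_def prefers_def inj_eq[OF Transposition.inj_transpose])

lemma swap_alts_rankings:
  assumes "V \<in> rankings A" "x \<in> A" "y \<in> A"
  shows "swap_alts x y V \<in> rankings A"
proof -
  have mem: "Transposition.transpose x y z \<in> A \<longleftrightarrow> z \<in> A" for z
    using assms(2,3) by (auto simp: Transposition.transpose_def)
  have V: "V \<subseteq> A \<times> A" "\<And>b. b \<in> A \<Longrightarrow> (b, b) \<in> V"
    "\<And>b c d. (b, c) \<in> V \<Longrightarrow> (c, d) \<in> V \<Longrightarrow> (b, d) \<in> V"
    "\<And>b c. (b, c) \<in> V \<Longrightarrow> (c, b) \<in> V \<Longrightarrow> b = c"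
    "\<And>b c. b \<in> A \<Longrightarrow> c \<in> A \<Longrightarrow> (b, c) \<in> V \<or> (c, b) \<in> V"
    using assms(1) unfolding rankings_iff by blast+
  let ?t = "Transposition.transpose x y"
  show ?thesis
    unfolding rankings_iff swap_alts_def in_inv_image
  proof (intro conjI allI ballI impI)
    show "inv_image V ?t \<subseteq> A \<times> A"
    proof (rule subrelI)
      fix b c assume "(b, c) \<in> inv_image V ?t"
      then have "(?t b, ?t c) \<in> A \<times> A" using V(1) by (simp add: subset_iff)
      then show "(b, c) \<in> A \<times> A" by (simp add: mem)
    qed
    show "(?t b, ?t b) \<in> V" if "b \<in> A" for b
      using that by (simp add: V(2) mem)
    show "(?t b, ?t d) \<in> V" if "(?t b, ?t c) \<in> V" "(?t c, ?t d) \<in> V" for b c d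
      using V(3)[OF that] .
    show "b = c" if "(?t b, ?t c) \<in> V" "(?t c, ?t b) \<in> V" for b c
      using V(4)[OF that] by (rule Transposition.transpose_eq_imp_eq)
    show "(?t b, ?t c) \<in> V \<or> (?t c, ?t b) \<in> V" if "b \<in> A" "c \<in> A" for b c
      using that by (intro V(5)) (simp_all add: mem)
  qed
qed

lemma bij_betw_swap_alts:
  assumes "x \<in> A" "y \<in> A"
  shows "bij_betw (swap_alts x y) (rankings A) (rankings A)"
  by (rule bij_betw_byWitness[of _ "swap_alts x y"])
    (use assms in \<open>auto intro: swap_alts_rankings\<close>)

definition adjacent :: "'a rel \<Rightarrow> 'a \<Rightarrow> 'a \<Rightarrow> bool" where
  "adjacent W x y \<longleftrightarrow> x \<succ>\<^bsub>W\<^esub> y \<and> (\<forall>z. \<not> (x \<succ>\<^bsub>W\<^esub> z \<and> z \<succ>\<^bsub>W\<^esub> y))"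

lemma prefers_swap_adjacent:
  assumes W: "W \<in> rankings A" and xy: "adjacent W x y"
  shows "b \<succ>\<^bsub>swap_alts x y W\<^esub> c \<longleftrightarrow>
    (b, c) = (y, x) \<or> b \<succ>\<^bsub>W\<^esub> c \<and> (b, c) \<noteq> (x, y)"
proof -
  have p: "x \<succ>\<^bsub>W\<^esub> y" and gap: "\<And>z. \<not> (x \<succ>\<^bsub>W\<^esub> z \<and> z \<succ>\<^bsub>W\<^esub> y)"
    using xy by (auto simp: adjacent_def)
  have mem: "x \<in> A" "y \<in> A" "x \<noteq> y" using prefers_in[OF W p] by auto
  have irr: "\<not> z \<succ>\<^bsub>W\<^esub> z" for z by (simp add: prefers_def)
  \<comment> \<open>No alternative separates \<open>x\<close> from \<open>y\<close>, so every third one compares with both alike.\<close>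
  have up: "z \<succ>\<^bsub>W\<^esub> x \<longleftrightarrow> z \<succ>\<^bsub>W\<^esub> y" if "z \<noteq> x" "z \<noteq> y" for z
    using p gap[of z] that mem not_prefers_iff[OF W, of x z] prefers_in(1)[OF W, of z]
      prefers_trans[OF W, of z x y] by blast
  have down: "x \<succ>\<^bsub>W\<^esub> z \<longleftrightarrow> y \<succ>\<^bsub>W\<^esub> z" if "z \<noteq> x" "z \<noteq> y" for z
    using p gap[of z] that mem not_prefers_iff[OF W, of z y] prefers_in(2)[OF W, of _ z]
      prefers_trans[OF W, of x y z] by blast
  have "\<not> y \<succ>\<^bsub>W\<^esub> x" using prefers_asym[OF W p] .
  then show ?thesis
    unfolding prefers_swap_alts using p mem irr up down
    by (cases "b = x"; cases "b = y"; cases "c = x"; cases "c = y") auto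
qed

section \<open>The Kendall-tau distance\<close>

definition disagreements :: "'a rel \<Rightarrow> 'a rel \<Rightarrow> ('a \<times> 'a) set" where
  "disagreements V W = {(b, c). b \<succ>\<^bsub>V\<^esub> c \<and> c \<succ>\<^bsub>W\<^esub> b}"

lemma mem_disagreements: "(b, c) \<in> disagreements V W \<longleftrightarrow> b \<succ>\<^bsub>V\<^esub> c \<and> c \<succ>\<^bsub>W\<^esub> b"
  by (simp add: disagreements_def)

lemma finite_disagreements: "finite A \<Longrightarrow> V \<in> rankings A \<Longrightarrow> finite (disagreements V W)"
  by (rule finite_subset[of _ "A \<times> A"]) (auto simp: disagreements_def dest: prefers_in)

lemma KT_eq_card_disagreements:
  assumes "V \<in> rankings A"
  shows "KT V W = card (disagreements V W)"
proof -
  have "{{b, c} | b c. b \<succ>\<^bsub>V\<^esub> c \<and> c \<succ>\<^bsub>W\<^esub> b} = (\<lambda>(b, c). {b, c}) ` disagreements V W"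
    by (auto simp: disagreements_def)
  moreover have "inj_on (\<lambda>(b, c). {b, c}) (disagreements V W)"
    using prefers_asym[OF assms] by (auto simp: inj_on_def disagreements_def doubleton_eq_iff)
  ultimately show ?thesis by (simp add: KT_def card_image)
qed

lemma KT_swap_alts:
  assumes "V \<in> rankings A" "x \<in> A" "y \<in> A"
  shows "KT (swap_alts x y V) (swap_alts x y W) = KT V W"
proof -
  have "bij_betw (map_prod (Transposition.transpose x y) (Transposition.transpose x y))
      (disagreements (swap_alts x y V) (swap_alts x y W)) (disagreements V W)"
    by (rule bij_betw_byWitness[of _ "map_prod (Transposition.transpose x y) (Transposition.transpose x y)"])
      (auto simp: disagreements_def prefers_swap_alts)
  then show ?thesis
    using KT_eq_card_disagreements swap_alts_rankings assms bij_betw_same_card by metis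
qed

lemma KT_swap_adjacent:
  assumes fin: "finite A" and V: "V \<in> rankings A" and W: "W \<in> rankings A"
    and xy: "adjacent W x y" and yx: "y \<succ>\<^bsub>V\<^esub> x"
  shows "KT V W = Suc (KT V (swap_alts x y W))"
proof -
  have "\<not> x \<succ>\<^bsub>V\<^esub> y" using prefers_asym[OF V yx] .
  then have "disagreements V W = insert (y, x) (disagreements V (swap_alts x y W))"
    using xy yx unfolding disagreements_def
    by (auto simp: prefers_swap_adjacent[OF W xy] adjacent_def)
  moreover have "(y, x) \<notin> disagreements V (swap_alts x y W)"
    using prefers_in(3)[OF V yx] by (auto simp: disagreements_def prefers_swap_adjacent[OF W xy])
  ultimately show ?thesis
    using finite_disagreements[OF fin V] by (simp add: KT_eq_card_disagreements[OF V])
qed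

text \<open>
  The pair sought is a disagreeing pair with as few alternatives as possible between its members: an
  alternative in between would form a closer disagreeing pair with one of the two. By
  \<open>KT_swap_adjacent\<close>, transposing such pairs repeatedly turns \<open>V\<close> into \<open>W\<close>.
\<close>

lemma adjacent_disagreement:
  assumes fin: "finite A" and V: "V \<in> rankings A" and W: "W \<in> rankings A" and "V \<noteq> W"
  obtains x y where "adjacent V x y" "y \<succ>\<^bsub>W\<^esub> x"
proof -
  define between where "between = (\<lambda>(x, y). {z. x \<succ>\<^bsub>V\<^esub> z \<and> z \<succ>\<^bsub>V\<^esub> y})"
  define bad where "bad = (\<lambda>(x, y). x \<succ>\<^bsub>V\<^esub> y \<and> y \<succ>\<^bsub>W\<^esub> x)"
  have "\<exists>p. bad p"
    using rankings_eqI[OF V W] \<open>V \<noteq> W\<close> not_prefers_iff[OF W] prefers_in[OF V]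
    by (fastforce simp: bad_def)
  then obtain p where p: "bad p" "\<And>q. bad q \<Longrightarrow> card (between p) \<le> card (between q)"
    using exists_least_iff[of "\<lambda>k. \<exists>p. bad p \<and> card (between p) = k"] by (metis not_le)
  obtain x y where xy: "p = (x, y)" by force
  have bad: "x \<succ>\<^bsub>V\<^esub> y" "y \<succ>\<^bsub>W\<^esub> x" using p(1) by (auto simp: bad_def xy)
  have "\<not> (x \<succ>\<^bsub>V\<^esub> z \<and> z \<succ>\<^bsub>V\<^esub> y)" for z
  proof
    assume z: "x \<succ>\<^bsub>V\<^esub> z \<and> z \<succ>\<^bsub>V\<^esub> y"
    have finb: "finite (between p)"
      by (rule finite_subset[OF _ fin]) (auto simp: between_def xy dest: prefers_in[OF V])
    have irr: "\<not> z \<succ>\<^bsub>V\<^esub> z" by (simp add: prefers_def)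
    have "z \<succ>\<^bsub>W\<^esub> x \<or> y \<succ>\<^bsub>W\<^esub> z"
      using z bad not_prefers_iff[OF W, of x z] prefers_in[OF V] prefers_trans[OF W, of y x z] by metis
    then have "bad (x, z) \<and> between (x, z) \<subset> between p \<or> bad (z, y) \<and> between (z, y) \<subset> between p"
      using z irr by (auto simp: bad_def between_def xy dest: prefers_trans[OF V])
    then show False
      using p(2) psubset_card_mono[OF finb] by (metis not_le)
  qed
  then show thesis using bad by (intro that[of x y]) (auto simp: adjacent_def)
qed

lemma KT_raise:
  assumes fin: "finite A" and V: "V \<in> rankings A" and W: "W \<in> L_above A B a" and a: "a \<in> A"
  shows "KT V (raise A a W) + card {b \<in> B. a \<succ>\<^bsub>V\<^esub> b} = KT V W + card {b \<in> B. b \<succ>\<^bsub>V\<^esub> a}"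
proof -
  let ?U = "raise A a W"
  have WR: "W \<in> rankings A" and B: "\<And>b. b \<in> B \<longleftrightarrow> b \<in> A \<and> b \<succ>\<^bsub>W\<^esub> a"
    using W by (auto simp: L_above_def)
  have finB: "finite B" using fin B by (metis finite_subset subsetI)
  have neq: "b \<noteq> a" if "b \<in> B" for b using that B by (auto simp: prefers_def)
  have raised: "b \<succ>\<^bsub>?U\<^esub> c \<longleftrightarrow> b = a \<and> c \<in> B \<or> b \<succ>\<^bsub>W\<^esub> c \<and> \<not> (b \<in> B \<and> c = a)" for b c
  proof -
    have irr: "\<not> a \<succ>\<^bsub>W\<^esub> a" by (simp add: prefers_def)
    have U: "b \<succ>\<^bsub>?U\<^esub> c \<longleftrightarrow>
        b \<in> A \<and> c \<in> A \<and> (b = a \<and> c \<noteq> a \<or> (b = a \<longleftrightarrow> c = a) \<and> b \<succ>\<^bsub>W\<^esub> c)"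
      by (auto simp: raise_def prefers_sort_by)
    show ?thesis
    proof (cases "b = a")
      case True
      then show ?thesis
        using U irr a B[of c] neq not_prefers_iff[OF WR a, of c] prefers_in(2)[OF WR, of a c] by blast
    next
      case False
      then show ?thesis
        using U irr a B[of b] B[of c] prefers_in(1,2)[OF WR, of b c] by blast
    qed
  qed
  define up where "up = (\<lambda>b. (b, a)) ` {b \<in> B. b \<succ>\<^bsub>V\<^esub> a}"
  define down where "down = (\<lambda>b. (a, b)) ` {b \<in> B. a \<succ>\<^bsub>V\<^esub> b}"
  have fin': "finite up" "finite down" unfolding up_def down_def using finB by auto
  have opposed: "b \<succ>\<^bsub>W\<^esub> a" "\<not> a \<succ>\<^bsub>W\<^esub> b" if "b \<in> B" for b
    using that B[of b] prefers_asym[OF WR, of b a] by blast+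
  have "disagreements V ?U \<union> down = disagreements V W \<union> up"
    unfolding up_def down_def using opposed by (auto simp: mem_disagreements raised)
  moreover have "disagreements V ?U \<inter> down = {}" "disagreements V W \<inter> up = {}"
    unfolding up_def down_def using opposed neq by (auto simp: mem_disagreements raised)
  then have "card (disagreements V ?U \<union> down) = card (disagreements V ?U) + card down"
    "card (disagreements V W \<union> up) = card (disagreements V W) + card up"
    using fin' finite_disagreements[OF fin V] by (auto intro: card_Un_disjoint)
  moreover have "card up = card {b \<in> B. b \<succ>\<^bsub>V\<^esub> a}" "card down = card {b \<in> B. a \<succ>\<^bsub>V\<^esub> b}"
    unfolding up_def down_def by (simp_all add: card_image inj_on_def)
  ultimately show ?thesis
    unfolding KT_eq_card_disagreements[OF V] by simp
qed

section \<open>Most powerful tests\<close>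

lemma expectation_finite:
  fixes f :: "'s \<Rightarrow> real"
  assumes "finite S" "set_pmf p \<subseteq> S"
  shows "measure_pmf.expectation p f = (\<Sum>s\<in>S. f s * pmf p s)"
  using assms by (intro integral_measure_pmf_real) auto

text \<open>
  The difference of the powers equals \<open>r K\<close> times the difference of the sizes plus a sum of terms
  \<open>(f s - g s) * (r (T s) - r K) * pmf p0 s\<close>. None of these is negative, because \<open>f\<close> takes an extreme
  value with the right sign on either side of the threshold, and \<open>r K\<close> is nonnegative as well. If \<open>g\<close>
  is as powerful as \<open>f\<close>, then all these terms vanish, so that \<open>g\<close> agrees with \<open>f\<close> away from the
  threshold.
\<close>

lemma neyman_pearson:
  fixes p0 p1 :: "'s pmf" and f g :: "'s \<Rightarrow> real" and T :: "'s \<Rightarrow> real" and r :: "real \<Rightarrow> real"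
  assumes S: "finite S" "set_pmf p0 \<subseteq> S" "set_pmf p1 \<subseteq> S"
    and ratio: "\<And>s. s \<in> S \<Longrightarrow> pmf p1 s = r (T s) * pmf p0 s"
    and r: "strict_mono r" "0 \<le> r K"
    and f: "\<And>s. s \<in> S \<Longrightarrow> K < T s \<Longrightarrow> f s = 1" "\<And>s. s \<in> S \<Longrightarrow> T s < K \<Longrightarrow> f s = 0"
    and g: "is_test S g"
    and level: "measure_pmf.expectation p0 g \<le> measure_pmf.expectation p0 f"
  shows neyman_pearson_optimal: "measure_pmf.expectation p1 g \<le> measure_pmf.expectation p1 f"
    and neyman_pearson_unique:
      "\<And>s. measure_pmf.expectation p1 f \<le> measure_pmf.expectation p1 g \<Longrightarrow>
        s \<in> set_pmf p0 \<Longrightarrow> T s \<noteq> K \<Longrightarrow> g s = f s"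
proof -
  define gain where "gain = (\<lambda>s. (f s - g s) * (r (T s) - r K) * pmf p0 s)"
  have g01: "0 \<le> g s" "g s \<le> 1" if "s \<in> S" for s
    using g that by (auto simp: is_test_def Pi_iff)
  have gain_nonneg: "0 \<le> gain s" if s: "s \<in> S" for s
  proof (cases "T s" K rule: linorder_cases)
    case less
    then have "r (T s) - r K < 0" using r(1) by (simp add: strict_mono_less)
    then have "0 \<le> (f s - g s) * (r (T s) - r K)"
      using f(2)[OF s less] g01[OF s] by (intro mult_nonpos_nonpos) auto
    then show ?thesis by (simp add: gain_def)
  next
    case greater
    then have "0 < r (T s) - r K" using r(1) by (simp add: strict_mono_less)
    then have "0 \<le> (f s - g s) * (r (T s) - r K)"
      using f(1)[OF s greater] g01[OF s] by (intro mult_nonneg_nonneg) auto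
    then show ?thesis by (simp add: gain_def)
  qed (simp add: gain_def)
  let ?E0 = "measure_pmf.expectation p0" and ?E1 = "measure_pmf.expectation p1"
  have "(\<Sum>s\<in>S. gain s) =
      (\<Sum>s\<in>S. f s * pmf p1 s - g s * pmf p1 s - r K * (f s * pmf p0 s - g s * pmf p0 s))"
    by (rule sum.cong) (simp_all add: gain_def ratio algebra_simps)
  also have "\<dots> = ?E1 f - ?E1 g - r K * (?E0 f - ?E0 g)"
    by (simp add: expectation_finite[OF S(1,2)] expectation_finite[OF S(1,3)]
        sum_subtractf sum_distrib_left right_diff_distrib)
  finally have total: "(\<Sum>s\<in>S. gain s) = ?E1 f - ?E1 g - r K * (?E0 f - ?E0 g)" .
  have slack: "0 \<le> r K * (?E0 f - ?E0 g)" using r(2) level by simp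
  have total_nonneg: "0 \<le> (\<Sum>s\<in>S. gain s)" using gain_nonneg by (rule sum_nonneg)
  show "?E1 g \<le> ?E1 f" using total slack total_nonneg by linarith
  show "g s = f s" if le: "?E1 f \<le> ?E1 g" and s: "s \<in> set_pmf p0" and "T s \<noteq> K" for s
  proof -
    have "(\<Sum>s\<in>S. gain s) = 0" using total slack total_nonneg le by linarith
    then have "gain s = 0" using sum_nonneg_eq_0_iff[OF S(1) gain_nonneg] s S(2) by auto
    moreover have "r (T s) \<noteq> r K" using r(1) \<open>T s \<noteq> K\<close> by (simp add: strict_mono_eq)
    ultimately show ?thesis using s by (simp add: gain_def set_pmf_iff)
  qed
qed

text \<open>
  As the threshold decreases, the probability of rejection rises from 0 to 1 in jumps; randomizing at
  the threshold where it would jump across \<open>\<alpha>\<close> hits \<open>\<alpha>\<close> exactly.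
\<close>

lemma threshold_exists:
  fixes p :: "'s pmf" and T :: "'s \<Rightarrow> int" and \<alpha> :: real
  assumes fin: "finite (set_pmf p)" and \<alpha>: "0 < \<alpha>" "\<alpha> < 1"
  obtains K :: int and \<Gamma> :: real where "\<Gamma> \<in> {0..1}"
    "measure_pmf.expectation p (\<lambda>s. if T s > K then 1 else if T s < K then 0 else \<Gamma>) = \<alpha>"
proof -
  define above where "above = (\<lambda>K. measure_pmf.prob p {s. K < T s})"
  obtain m where m: "\<And>s. s \<in> set_pmf p \<Longrightarrow> \<bar>T s\<bar> \<le> m"
    using fin by (metis finite_imageI finite_has_maximal2 Max_ge image_eqI)
  have top: "above m = 0"
    unfolding above_def using m by (intro measure_pmf.prob_eq_0[THEN iffD2] AE_pmfI)
      (force simp: AE_measure_pmf_iff)+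
  have bot: "above (- m - 1) = 1"
    unfolding above_def using m by (subst measure_pmf.prob_eq_1) (force simp: AE_measure_pmf_iff)+
  have "m \<ge> 0" using set_pmf_not_empty[of p] m by force
  \<comment> \<open>The least element is taken over offsets from \<open>- m - 1\<close>, where everything is above the threshold.\<close>
  define k where "k = (LEAST k. above (- m - 1 + int k) \<le> \<alpha>)"
  have ex: "above (- m - 1 + int (nat (2 * m + 1))) \<le> \<alpha>" using top \<alpha> \<open>m \<ge> 0\<close> by simp
  have k: "above (- m - 1 + int k) \<le> \<alpha>" unfolding k_def
    by (rule LeastI[where P = "\<lambda>k. above (- m - 1 + int k) \<le> \<alpha>", OF ex])
  have "k \<noteq> 0" using k bot \<alpha> by (intro notI) simp
  then have k': "\<alpha> < above (- m - 1 + int (k - 1))"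
    using not_less_Least[of "k - 1" "\<lambda>k. above (- m - 1 + int k) \<le> \<alpha>"] by (simp add: k_def)
  define K where "K = - m - 1 + int k"
  have K: "above K \<le> \<alpha>" "\<alpha> < above (K - 1)"
    using k k' \<open>k \<noteq> 0\<close> by (simp_all add: K_def of_nat_diff algebra_simps)
  define atom where "atom = measure_pmf.prob p {s. T s = K}"
  have "{s. K - 1 < T s} = {s. K < T s} \<union> {s. T s = K}" by auto
  then have jump: "above (K - 1) = above K + atom"
    unfolding above_def atom_def by (simp add: measure_pmf.finite_measure_Union disjoint_iff)
  define \<Gamma> where "\<Gamma> = (\<alpha> - above K) / atom"
  have atom: "0 < atom" using K jump by linarith
  have "\<Gamma> \<in> {0..1}" using K jump atom by (auto simp: \<Gamma>_def field_simps)
  moreover have "measure_pmf.expectation p (\<lambda>s. if T s > K then 1 else if T s < K then 0 else \<Gamma>) = \<alpha>"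
  proof -
    have "(\<lambda>s. if T s > K then 1 else if T s < K then 0 else \<Gamma>) =
        (\<lambda>s. indicator {s. K < T s} s + \<Gamma> * indicator {s. T s = K} s)"
      by (auto simp: fun_eq_iff indicator_def)
    then have "measure_pmf.expectation p (\<lambda>s. if T s > K then 1 else if T s < K then 0 else \<Gamma>) =
        above K + \<Gamma> * atom"
      by (simp add: integrable_measure_pmf_finite[OF fin] above_def atom_def)
    then show ?thesis using atom by (simp add: \<Gamma>_def)
  qed
  ultimately show thesis by (rule that)
qed

section \<open>Independent samples\<close>

lemma pmf_replicate_Cons:
  "pmf (replicate_pmf (Suc n) p) (x # xs) = pmf p x * pmf (replicate_pmf n p) xs"
proof -
  have "replicate_pmf (Suc n) p = map_pmf (\<lambda>(x, xs). x # xs) (pair_pmf p (replicate_pmf n p))"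
    by (simp add: pair_pmf_def map_bind_pmf)
  moreover have "inj (\<lambda>(x :: 'a, xs). x # xs)" by (auto simp: inj_def)
  ultimately show ?thesis
    using pmf_map_inj'[of "\<lambda>(x, xs). x # xs" "pair_pmf p (replicate_pmf n p)" "(x, xs)"]
    by (simp add: pmf_pair)
qed

lemma likelihood_ratio_replicate:
  fixes t :: "'b \<Rightarrow> int"
  assumes ratio: "\<And>x. x \<in> X \<Longrightarrow> pmf p1 x = c * \<phi> powr (- of_int (t x)) * pmf p0 x"
    and xs: "xs \<in> lists X" "0 < (\<phi> :: real)"
  shows "pmf (replicate_pmf (length xs) p1) xs =
    c ^ length xs * \<phi> powr (- of_int (sum_list (map t xs))) * pmf (replicate_pmf (length xs) p0) xs"
  using xs(1)
proof (induction xs)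
  case Nil
  then show ?case using xs(2) by simp
next
  case (Cons x xs)
  have "\<phi> powr (- of_int (t x) - of_int (sum_list (map t xs))) =
      \<phi> powr (- of_int (t x)) * \<phi> powr (- of_int (sum_list (map t xs)))"
    using powr_add[of \<phi> "- of_int (t x)" "- of_int (sum_list (map t xs))"] by simp
  then show ?case
    using Cons by (simp only: pmf_replicate_Cons ratio length_Cons) (auto simp: pmf_replicate_Cons ratio)
qed

text \<open>Sums of independent variables inherit stochastic dominance, one summand being replaced at a time.\<close>

lemma replicate_pmf_sum_mono:
  fixes t :: "'b \<Rightarrow> int" and g :: "int \<Rightarrow> real"
  assumes fin: "finite (set_pmf p)" "finite (set_pmf q)"
    and dom: "\<And>g :: int \<Rightarrow> real. mono g \<Longrightarrow>
      measure_pmf.expectation p (\<lambda>x. g (t x)) \<le> measure_pmf.expectation q (\<lambda>x. g (t x))"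
    and g: "mono g"
  shows "measure_pmf.expectation (replicate_pmf n p) (\<lambda>xs. g (sum_list (map t xs))) \<le>
    measure_pmf.expectation (replicate_pmf n q) (\<lambda>xs. g (sum_list (map t xs)))"
  using g
proof (induction n arbitrary: g)
  case 0
  then show ?case by simp
next
  case (Suc n)
  let ?E = "\<lambda>r h. measure_pmf.expectation (replicate_pmf n r) h"
  have fin_rep: "finite (set_pmf (replicate_pmf k r))" if "finite (set_pmf r)" for k and r :: "'b pmf"
    using that finite_lists_length_eq[of "set_pmf r" k]
    by (auto simp: set_replicate_pmf lists_eq_set conj_commute)
  have unfold: "measure_pmf.expectation (replicate_pmf (Suc n) r) (\<lambda>xs. g (sum_list (map t xs))) =
      measure_pmf.expectation r (\<lambda>x. ?E r (\<lambda>xs. g (t x + sum_list (map t xs))))"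
    if r: "finite (set_pmf r)" for r
  proof -
    have "measure_pmf.expectation (replicate_pmf (Suc n) r) (\<lambda>xs. g (sum_list (map t xs))) =
        (\<Sum>x\<in>set_pmf r. pmf r x *\<^sub>R measure_pmf.expectation
          (map_pmf ((#) x) (replicate_pmf n r)) (\<lambda>xs. g (sum_list (map t xs))))"
      unfolding replicate_pmf.simps map_pmf_def
      by (rule pmf_expectation_bind) (use r fin_rep in \<open>auto simp: map_pmf_def[symmetric]\<close>)
    then show ?thesis
      by (simp add: expectation_finite[OF r order_refl] mult.commute)
  qed
  have mono_shift: "mono (\<lambda>z. g (z + s))" for s
    using Suc.prems by (auto simp: mono_def)
  have mono_shift': "mono (\<lambda>s. g (z + s))" for z
    using Suc.prems by (auto simp: mono_def)
  have "measure_pmf.expectation p (\<lambda>x. ?E p (\<lambda>xs. g (t x + sum_list (map t xs)))) \<le>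
      measure_pmf.expectation p (\<lambda>x. ?E q (\<lambda>xs. g (t x + sum_list (map t xs))))"
    by (intro integral_mono integrable_measure_pmf_finite fin Suc.IH mono_shift')
  also have "\<dots> \<le> measure_pmf.expectation q (\<lambda>x. ?E q (\<lambda>xs. g (t x + sum_list (map t xs))))"
    by (intro dom monoI integral_mono integrable_measure_pmf_finite fin fin_rep monoD[OF mono_shift])
  finally show ?case by (simp only: unfold fin)
qed

section \<open>The margin of a set of alternatives under Mallows' model\<close>

definition vote_margin :: "'a set \<Rightarrow> 'a \<Rightarrow> 'a rel \<Rightarrow> int" where
  "vote_margin B a V = int (card {b \<in> B. b \<succ>\<^bsub>V\<^esub> a}) - int (card {b \<in> B. a \<succ>\<^bsub>V\<^esub> b})"

lemma margin_set_eq_sum_list: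
  assumes "finite B"
  shows "margin_set P B a = sum_list (map (vote_margin B a) P)"
proof -
  have votes: "votes P b c = length (filter (\<lambda>V. b \<succ>\<^bsub>V\<^esub> c) P)" for P b and c :: 'a
    by (simp add: votes_def length_filter_conv_card)
  have single: "vote_margin B a V = (\<Sum>b\<in>B. of_bool (b \<succ>\<^bsub>V\<^esub> a) - of_bool (a \<succ>\<^bsub>V\<^esub> b))" for V
    using assms by (simp add: vote_margin_def sum_subtractf Int_def)
  show ?thesis
    unfolding margin_set_def margin_def votes
  proof (induction P)
    case (Cons V P)
    have "(\<Sum>b\<in>B. int (length (filter (\<lambda>V. b \<succ>\<^bsub>V\<^esub> a) (V # P))) -
          int (length (filter (\<lambda>V. a \<succ>\<^bsub>V\<^esub> b) (V # P)))) =
        vote_margin B a V + (\<Sum>b\<in>B. int (length (filter (\<lambda>V. b \<succ>\<^bsub>V\<^esub> a) P)) -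
          int (length (filter (\<lambda>V. a \<succ>\<^bsub>V\<^esub> b) P)))"
      unfolding single sum.distrib[symmetric] by (rule sum.cong) auto
    then show ?case using Cons.IH by simp
  qed simp
qed

lemma vote_margin_ranking:
  assumes V: "V \<in> rankings A" and fin: "finite A" and B: "B \<subseteq> A - {a}" and a: "a \<in> A"
  shows "vote_margin B a V = 2 * int (card {b \<in> B. b \<succ>\<^bsub>V\<^esub> a}) - int (card B)"
proof -
  have finB: "finite B" using fin B finite_subset by blast
  have "b \<succ>\<^bsub>V\<^esub> a \<longleftrightarrow> \<not> a \<succ>\<^bsub>V\<^esub> b" if "b \<in> B" for b
    using that not_prefers_iff[OF V a, of b] B by auto
  then have "{b \<in> B. a \<succ>\<^bsub>V\<^esub> b} = B - {b \<in> B. b \<succ>\<^bsub>V\<^esub> a}" by auto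
  then have "card {b \<in> B. a \<succ>\<^bsub>V\<^esub> b} = card B - card {b \<in> B. b \<succ>\<^bsub>V\<^esub> a}"
    using finB by (simp add: card_Diff_subset)
  moreover have "card {b \<in> B. b \<succ>\<^bsub>V\<^esub> a} \<le> card B" using finB by (intro card_mono) auto
  ultimately show ?thesis by (simp add: vote_margin_def)
qed

lemma vote_margin_L_above:
  assumes "V \<in> L_above A C a" "finite A" "B \<subseteq> A - {a}" "a \<in> A"
  shows "vote_margin B a V = 2 * int (card (B \<inter> C)) - int (card B)"
proof -
  have V: "V \<in> rankings A" and "C = {b \<in> A. b \<succ>\<^bsub>V\<^esub> a}" using assms(1) by (auto simp: L_above_def)
  then have "{b \<in> B. b \<succ>\<^bsub>V\<^esub> a} = B \<inter> C" using assms(3) by auto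
  then show ?thesis using vote_margin_ranking[OF V assms(2-4)] by simp
qed

lemma vote_margin_swap_le:
  assumes V: "V \<in> rankings A" and fin: "finite A" and B: "B \<subseteq> A - {a}" and a: "a \<in> A"
    and yx: "y \<succ>\<^bsub>V\<^esub> x" and neq: "x \<noteq> a" "y \<noteq> a" and xyB: "x \<in> B \<Longrightarrow> y \<in> B"
  shows "vote_margin B a (swap_alts x y V) \<le> vote_margin B a V"
proof -
  have mem: "x \<in> A" "y \<in> A" using prefers_in[OF V yx] by auto
  have finB: "finite B" using fin B finite_subset by blast
  let ?t = "Transposition.transpose x y"
  have a_fixed: "?t a = a" using neq by simp
  have "card {b \<in> B. b \<succ>\<^bsub>swap_alts x y V\<^esub> a} \<le> card {b \<in> B. b \<succ>\<^bsub>V\<^esub> a}"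
  proof (cases "x \<in> B")
    case True
    have "?t ` {b \<in> B. ?t b \<succ>\<^bsub>V\<^esub> a} \<subseteq> {b \<in> B. b \<succ>\<^bsub>V\<^esub> a}"
      using True xyB by (auto simp: Transposition.transpose_def)
    then have "card (?t ` {b \<in> B. ?t b \<succ>\<^bsub>V\<^esub> a}) \<le> card {b \<in> B. b \<succ>\<^bsub>V\<^esub> a}"
      using finB by (intro card_mono) auto
    then show ?thesis by (simp add: prefers_swap_alts a_fixed card_image)
  next
    case False
    have "{b \<in> B. b \<succ>\<^bsub>swap_alts x y V\<^esub> a} \<subseteq> {b \<in> B. b \<succ>\<^bsub>V\<^esub> a}"
    proof clarify
      fix b assume b: "b \<in> B" "b \<succ>\<^bsub>swap_alts x y V\<^esub> a"
      then have "?t b \<succ>\<^bsub>V\<^esub> a" by (simp add: prefers_swap_alts a_fixed)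
      then show "b \<succ>\<^bsub>V\<^esub> a"
        using False b(1) prefers_trans[OF V yx, of a]
        by (cases "b = y") (auto simp: Transposition.transpose_def split: if_splits)
    qed
    then show ?thesis using finB by (intro card_mono) auto
  qed
  then show ?thesis
    using vote_margin_ranking[OF V fin B a]
      vote_margin_ranking[OF swap_alts_rankings[OF V mem] fin B a] by simp
qed

lemma expectation_mallows:
  fixes f :: "'a rel \<Rightarrow> real"
  assumes "finite A" "0 < \<phi>"
  shows "measure_pmf.expectation (mallows A \<phi> W) f =
    (\<Sum>V\<in>rankings A. \<phi> ^ KT V W * f V) / mallows_Z A \<phi> W"
proof -
  have "set_pmf (mallows A \<phi> W) \<subseteq> rankings A"
    using assms by (auto simp: set_pmf_iff pmf_mallows split: if_splits)
  then show ?thesis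
    using assms by (simp add: expectation_finite[OF finite_rankings] pmf_mallows
        sum_divide_distrib mult.commute cong: sum.cong)
qed

lemma mallows_Z_swap_alts:
  assumes "x \<in> A" "y \<in> A"
  shows "mallows_Z A \<phi> (swap_alts x y W) = mallows_Z A \<phi> W"
proof -
  have "mallows_Z A \<phi> (swap_alts x y W) =
      (\<Sum>V\<in>rankings A. \<phi> ^ KT (swap_alts x y V) (swap_alts x y W))"
    unfolding mallows_Z_def by (rule sum.reindex_bij_betw[OF bij_betw_swap_alts[OF assms], symmetric])
  also have "\<dots> = mallows_Z A \<phi> W"
    unfolding mallows_Z_def using assms by (intro sum.cong refl) (simp add: KT_swap_alts)
  finally show ?thesis .
qed

text \<open>
  Renaming \<open>x\<close> and \<open>y\<close> exchanges the two centres, so up to their common normalization the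
  difference of the expectations is half of
  \<open>\<Sum>V. (\<phi> ^ KT V W' - \<phi> ^ KT V W) * (g (t V) - g (t V'))\<close>, where a prime marks the exchange and \<open>t\<close> is
  the margin of a vote. Both factors are nonnegative if \<open>V\<close> prefers \<open>y\<close> to \<open>x\<close>, and both are
  nonpositive otherwise.
\<close>

lemma mallows_swap_mono:
  fixes g :: "int \<Rightarrow> real"
  assumes fin: "finite A" and \<phi>: "0 < \<phi>" "\<phi> < 1" and W: "W \<in> rankings A" and xy: "adjacent W x y"
    and B: "B \<subseteq> A - {a}" and a: "a \<in> A" and neq: "x \<noteq> a" "y \<noteq> a"
    and xyB: "x \<in> B \<Longrightarrow> y \<in> B" and g: "mono g"
  shows "measure_pmf.expectation (mallows A \<phi> W) (\<lambda>V. g (vote_margin B a V)) \<le>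
    measure_pmf.expectation (mallows A \<phi> (swap_alts x y W)) (\<lambda>V. g (vote_margin B a V))"
proof -
  have mem: "x \<in> A" "y \<in> A" "x \<noteq> y" using prefers_in[OF W] xy by (auto simp: adjacent_def)
  define s where "s = swap_alts x y"
  define q where "q = (\<lambda>(V :: 'a rel) (W :: 'a rel). \<phi> ^ KT V W)"
  define h where "h = (\<lambda>V. g (vote_margin B a V))"
  have s_ranking: "s V \<in> rankings A" if "V \<in> rankings A" for V
    using that mem by (simp add: s_def swap_alts_rankings)
  have invol: "s (s V) = V" for V by (simp add: s_def)
  have q_swap: "q (s V) (s U) = q V U" if "V \<in> rankings A" for V U
    using that mem by (simp add: q_def s_def KT_swap_alts)
  have reindex: "(\<Sum>V\<in>rankings A. F (s V)) = (\<Sum>V\<in>rankings A. F V)" for F :: "'a rel \<Rightarrow> real"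
    unfolding s_def by (rule sum.reindex_bij_betw[OF bij_betw_swap_alts[OF mem(1,2)]])
  have favours: "0 \<le> (q V (s W) - q V W) * (h V - h (s V))"
    if V: "V \<in> rankings A" and yx: "y \<succ>\<^bsub>V\<^esub> x" for V
  proof -
    have "q V W \<le> q V (s W)"
      using KT_swap_adjacent[OF fin V W xy yx] \<phi> by (simp add: q_def s_def mult_left_le_one_le)
    moreover have "h (s V) \<le> h V"
      unfolding h_def s_def by (intro monoD[OF g] vote_margin_swap_le[OF V fin B a yx neq xyB])
    ultimately show ?thesis by simp
  qed
  have nonneg: "0 \<le> (q V (s W) - q V W) * (h V - h (s V))" if V: "V \<in> rankings A" for V
  proof (cases "y \<succ>\<^bsub>V\<^esub> x")
    case True
    then show ?thesis using favours[OF V] by simp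
  next
    case False
    then have "x \<succ>\<^bsub>V\<^esub> y" using not_prefers_iff[OF V, of y x] mem by auto
    then have "y \<succ>\<^bsub>s V\<^esub> x" by (simp add: s_def prefers_swap_alts)
    \<comment> \<open>The term of \<open>V\<close> equals that of the exchanged vote, which prefers \<open>y\<close> to \<open>x\<close>.\<close>
    then have "0 \<le> (q (s V) (s W) - q (s V) W) * (h (s V) - h (s (s V)))"
      using favours s_ranking[OF V] by blast
    moreover have "q (s V) W = q V (s W)"
      using q_swap[OF V, of "s W"] by (simp add: invol)
    ultimately show ?thesis
      by (simp add: invol q_swap[OF V] algebra_simps)
  qed
  have "(\<Sum>V\<in>rankings A. q V (s W) * h (s V)) = (\<Sum>V\<in>rankings A. q (s V) (s W) * h (s (s V)))"
    by (rule reindex[symmetric])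
  also have "\<dots> = (\<Sum>V\<in>rankings A. q V W * h V)" by (intro sum.cong refl) (simp add: invol q_swap)
  finally have 1: "(\<Sum>V\<in>rankings A. q V (s W) * h (s V)) = (\<Sum>V\<in>rankings A. q V W * h V)" .
  have "(\<Sum>V\<in>rankings A. q V W * h (s V)) = (\<Sum>V\<in>rankings A. q (s V) (s W) * h (s V))"
    by (intro sum.cong refl) (simp add: q_swap)
  also have "\<dots> = (\<Sum>V\<in>rankings A. q V (s W) * h V)" by (rule reindex)
  finally have 2: "(\<Sum>V\<in>rankings A. q V W * h (s V)) = (\<Sum>V\<in>rankings A. q V (s W) * h V)" .
  have "0 \<le> (\<Sum>V\<in>rankings A. (q V (s W) - q V W) * (h V - h (s V)))"
    by (rule sum_nonneg) (rule nonneg)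
  also have "\<dots> = 2 * ((\<Sum>V\<in>rankings A. q V (s W) * h V) - (\<Sum>V\<in>rankings A. q V W * h V))"
    using 1 2 by (simp add: left_diff_distrib right_diff_distrib sum_subtractf)
  finally have "(\<Sum>V\<in>rankings A. q V W * h V) \<le> (\<Sum>V\<in>rankings A. q V (s W) * h V)" by simp
  then show ?thesis
    using mallows_Z_swap_alts[OF mem(1,2)] mallows_Z_pos[OF fin \<phi>(1)]
    by (simp add: expectation_mallows[OF fin \<phi>(1)] q_def h_def s_def divide_right_mono less_imp_le)
qed

text \<open>
  Among the centres with \<open>a\<close> on top, those in which \<open>B\<close> follows immediately after \<open>a\<close> make large margins
  of \<open>B\<close> over \<open>a\<close> most likely. On the way to such a centre by adjacent transpositions no member of
  \<open>B\<close> is ever moved below a member of the complement, so each step can only raise the margin.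
\<close>

lemma mallows_block_dominates:
  fixes g :: "int \<Rightarrow> real"
  assumes fin: "finite A" and \<phi>: "0 < \<phi>" "\<phi> < 1" and B: "B \<subseteq> A - {a}" and a: "a \<in> A"
    and W0: "W0 \<in> L_top A a" and block: "\<And>b c. b \<in> B \<Longrightarrow> c \<in> A - B - {a} \<Longrightarrow> b \<succ>\<^bsub>W0\<^esub> c"
    and W: "W \<in> L_top A a" and g: "mono g"
  shows "measure_pmf.expectation (mallows A \<phi> W) (\<lambda>V. g (vote_margin B a V)) \<le>
    measure_pmf.expectation (mallows A \<phi> W0) (\<lambda>V. g (vote_margin B a V))"
  using W
proof (induction "KT W0 W" arbitrary: W rule: less_induct)
  case less
  have WR: "W \<in> rankings A" and W0R: "W0 \<in> rankings A"
    using less.prems W0 by (simp_all add: L_top_def)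
  show ?case
  proof (cases "W = W0")
    case False
    then obtain x y where xy: "adjacent W x y" and yx: "y \<succ>\<^bsub>W0\<^esub> x"
      using adjacent_disagreement[OF fin WR W0R] by blast
    have p: "x \<succ>\<^bsub>W\<^esub> y" using xy by (simp add: adjacent_def)
    have mem: "x \<in> A" "y \<in> A" "x \<noteq> y" using prefers_in[OF WR p] by auto
    have neq: "x \<noteq> a" "y \<noteq> a"
      using L_top_prefers[OF W0 mem(2)] L_top_prefers[OF less.prems mem(1)] mem(3)
        prefers_asym[OF W0R yx] prefers_asym[OF WR p] by auto
    have xyB: "y \<in> B" if "x \<in> B"
      using block[OF that, of y] prefers_asym[OF W0R yx] mem(2) neq(2) by auto
    have "swap_alts x y W \<in> L_top A a"
      using less.prems neq swap_alts_rankings[OF WR mem(1,2)]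
      by (auto simp: L_top_def prefers_swap_adjacent[OF WR xy])
    moreover have "KT W0 (swap_alts x y W) < KT W0 W"
      using KT_swap_adjacent[OF fin W0R WR xy yx] by simp
    ultimately have "measure_pmf.expectation (mallows A \<phi> (swap_alts x y W)) (\<lambda>V. g (vote_margin B a V)) \<le>
        measure_pmf.expectation (mallows A \<phi> W0) (\<lambda>V. g (vote_margin B a V))"
      using less.hyps by blast
    with mallows_swap_mono[OF fin \<phi> WR xy B a neq xyB g] show ?thesis by linarith
  qed simp
qed

lemma finite_profiles: "finite A \<Longrightarrow> finite (profiles A n)"
  using finite_lists_length_eq[OF finite_rankings, of A n]
  by (simp add: profiles_def lists_eq_set Collect_conj_eq)

lemma finite_L_top: "finite A \<Longrightarrow> finite (L_top A a)"
  using finite_subset[OF L_top_subset_rankings finite_rankings] .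

lemma size_at_le_size_test:
  assumes "finite A" "h \<in> L_top A a"
  shows "size_at M f h \<le> size_test M (L_top A a) f"
  unfolding size_test_def using assms
  by (intro cSUP_upper bdd_above_finite finite_imageI finite_L_top)

lemma size_threshold_test:
  assumes fin: "finite A" and \<phi>: "0 < \<phi>" "\<phi> < 1" and B: "B \<subseteq> A - {a}" and a: "a \<in> A"
    and W0: "W0 \<in> L_top A a" and block: "\<And>b c. b \<in> B \<Longrightarrow> c \<in> A - B - {a} \<Longrightarrow> b \<succ>\<^bsub>W0\<^esub> c"
    and \<Gamma>: "\<Gamma> \<in> {0..1}"
  shows "size_test (mallows_model A n \<phi>) (L_top A a) (threshold_test a B K \<Gamma>) =
    size_at (mallows_model A n \<phi>) (threshold_test a B K \<Gamma>) W0"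
proof -
  define g where "g = (\<lambda>z :: int. if of_int z > K then 1 else if of_int z < K then 0 else \<Gamma>)"
  have g: "mono g" using \<Gamma> by (auto simp: mono_def g_def)
  have finB: "finite B" using fin B finite_subset by blast
  have f: "threshold_test a B K \<Gamma> = (\<lambda>P. g (sum_list (map (vote_margin B a) P)))"
    by (simp add: threshold_test_def g_def margin_set_eq_sum_list[OF finB] fun_eq_iff)
  have fin_set: "finite (set_pmf (mallows A \<phi> W))" for W
    by (rule finite_subset[OF _ finite_rankings[OF fin]])
      (auto simp: set_pmf_iff pmf_mallows[OF fin \<phi>(1)] split: if_splits)
  have "size_at (mallows_model A n \<phi>) (threshold_test a B K \<Gamma>) W \<le>
      size_at (mallows_model A n \<phi>) (threshold_test a B K \<Gamma>) W0" if W: "W \<in> L_top A a" for W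
    unfolding size_at_def mallows_model_def f
    by (intro replicate_pmf_sum_mono fin_set g mallows_block_dominates[OF fin \<phi> B a W0 block W])
  then show ?thesis
    unfolding size_test_def using W0 by (intro cSup_eq_maximum) auto
qed

text \<open>
  For a centre with exactly \<open>B\<close> above \<open>a\<close>, the likelihood ratio against the same centre with \<open>a\<close>
  raised is an increasing function of the margin of \<open>B\<close> over \<open>a\<close> alone: the two centres differ only
  in the pairs formed by \<open>a\<close> and the members of \<open>B\<close>.
\<close>

lemma mallows_likelihood_ratio:
  assumes fin: "finite A" and \<phi>: "0 < \<phi>" and W: "W \<in> L_above A B a" and a: "a \<in> A"
    and B: "B \<subseteq> A - {a}"
  obtains c where "0 < c" "\<And>P. P \<in> profiles A n \<Longrightarrow> pmf (mallows_model A n \<phi> W) P =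
    c * \<phi> powr (- of_int (margin_set P B a)) * pmf (mallows_model A n \<phi> (raise A a W)) P"
proof
  let ?c = "mallows_Z A \<phi> (raise A a W) / mallows_Z A \<phi> W"
  have Z: "0 < mallows_Z A \<phi> U" for U using mallows_Z_pos[OF fin \<phi>] .
  show "0 < ?c ^ n" using Z by simp
  have finB: "finite B" using fin B finite_subset by blast
  have vote: "pmf (mallows A \<phi> W) V =
      ?c * \<phi> powr (- of_int (vote_margin B a V)) * pmf (mallows A \<phi> (raise A a W)) V"
    if V: "V \<in> rankings A" for V
  proof -
    have "int (KT V W) = int (KT V (raise A a W)) - vote_margin B a V"
      using KT_raise[OF fin V W a] by (simp add: vote_margin_def)
    then have "real_of_int (int (KT V W)) = real_of_int (int (KT V (raise A a W)) - vote_margin B a V)"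
      by (rule arg_cong)
    then have "real (KT V W) = - of_int (vote_margin B a V) + real (KT V (raise A a W))" by simp
    then have "\<phi> powr real (KT V W) =
        \<phi> powr (- of_int (vote_margin B a V)) * \<phi> powr real (KT V (raise A a W))"
      by (simp only: powr_add)
    then have "\<phi> ^ KT V W = \<phi> powr (- of_int (vote_margin B a V)) * \<phi> ^ KT V (raise A a W)"
      using \<phi> by (simp add: powr_realpow)
    then show ?thesis using V Z[of W] Z[of "raise A a W"] by (simp add: pmf_mallows[OF fin \<phi>])
  qed
  show "pmf (mallows_model A n \<phi> W) P =
      ?c ^ n * \<phi> powr (- of_int (margin_set P B a)) * pmf (mallows_model A n \<phi> (raise A a W)) P"
    if "P \<in> profiles A n" for P
    using likelihood_ratio_replicate[OF vote, of "rankings A" P] that \<phi>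
    by (auto simp: profiles_def mallows_model_def margin_set_eq_sum_list[OF finB])
qed

section \<open>The threshold tests\<close>

lemma threshold_test_is_test: "\<Gamma> \<in> {0..1} \<Longrightarrow> is_test S (threshold_test a B K \<Gamma>)"
  by (auto simp: is_test_def threshold_test_def)

lemma threshold_test_size_exists:
  assumes fin: "finite A" and \<phi>: "0 < \<phi>" "\<phi> < 1" and B: "B \<subseteq> A - {a}" and a: "a \<in> A"
    and \<alpha>: "0 < \<alpha>" "\<alpha> < 1"
  shows "\<exists>K. \<exists>\<Gamma>\<in>{0..1}.
    size_test (mallows_model A n \<phi>) (L_top A a) (threshold_test a B K \<Gamma>) = \<alpha>"
proof -
  obtain W where W: "W \<in> L_above A B a" using L_above_nonempty[OF B a] .
  then have WR: "W \<in> rankings A" by (simp add: L_above_def)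
  let ?W0 = "raise A a W"
  have fin_support: "finite (set_pmf (mallows_model A n \<phi> ?W0))"
    using finite_profiles[OF fin] by (simp add: set_pmf_mallows_model[OF fin \<phi>(1)])
  obtain K :: int and \<Gamma> where \<Gamma>: "\<Gamma> \<in> {0..1}" and size: "measure_pmf.expectation
      (mallows_model A n \<phi> ?W0)
      (\<lambda>P. if margin_set P B a > K then 1 else if margin_set P B a < K then 0 else \<Gamma>) = \<alpha>"
    by (rule threshold_exists[OF fin_support \<alpha>, of "\<lambda>P. margin_set P B a"])
  have "size_test (mallows_model A n \<phi>) (L_top A a) (threshold_test a B (of_int K) \<Gamma>) =
      size_at (mallows_model A n \<phi>) (threshold_test a B (of_int K) \<Gamma>) ?W0"
    by (rule size_threshold_test[OF fin \<phi> B a raise_in_L_top[OF WR a] raise_block[OF W _ _ a] \<Gamma>])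
  also have "\<dots> = \<alpha>"
    using size by (simp add: size_at_def threshold_test_def[abs_def] cong: if_cong)
  finally show ?thesis using \<Gamma> by blast
qed

text \<open>
  The Neyman-Pearson lemma is applied to a single null hypothesis, the ranking \<open>W\<close> with \<open>a\<close> raised.
  It is least favourable: the size of the threshold test is attained there, and every other test of
  that level respects the level there in particular.
\<close>

lemma
  assumes fin: "finite A" and \<phi>: "0 < \<phi>" "\<phi> < 1" and B: "B \<subseteq> A - {a}" and a: "a \<in> A"
    and W: "W \<in> L_above A B a" and \<Gamma>: "\<Gamma> \<in> {0..1}"
    and g: "is_test (profiles A n) g"
    and level: "size_test (mallows_model A n \<phi>) (L_top A a) g \<le>
      size_test (mallows_model A n \<phi>) (L_top A a) (threshold_test a B K \<Gamma>)"
  shows threshold_test_most_powerful: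
      "power_at (mallows_model A n \<phi>) g W \<le>
        power_at (mallows_model A n \<phi>) (threshold_test a B K \<Gamma>) W"
    and threshold_test_unique:
      "\<And>P. power_at (mallows_model A n \<phi>) (threshold_test a B K \<Gamma>) W \<le>
          power_at (mallows_model A n \<phi>) g W \<Longrightarrow>
        P \<in> profiles A n \<Longrightarrow> of_int (margin_set P B a) \<noteq> K \<Longrightarrow>
        g P = threshold_test a B K \<Gamma> P"
proof -
  let ?M = "mallows_model A n \<phi>" and ?f = "threshold_test a B K \<Gamma>" and ?W0 = "raise A a W"
  have W0: "?W0 \<in> L_top A a" using W a by (intro raise_in_L_top) (auto simp: L_above_def)
  have support: "set_pmf (?M U) = profiles A n" for U by (rule set_pmf_mallows_model[OF fin \<phi>(1)])
  obtain c where c: "0 < c" and ratio: "\<And>P. P \<in> profiles A n \<Longrightarrow> pmf (?M W) P =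
      c * \<phi> powr (- of_int (margin_set P B a)) * pmf (?M ?W0) P"
    using mallows_likelihood_ratio[OF fin \<phi>(1) W a B] by blast
  have "size_at ?M g ?W0 \<le> size_test ?M (L_top A a) g"
    by (rule size_at_le_size_test[OF fin W0])
  also have "\<dots> \<le> size_test ?M (L_top A a) ?f" by (rule level)
  also have "\<dots> = size_at ?M ?f ?W0"
    by (rule size_threshold_test[OF fin \<phi> B a W0 raise_block[OF W _ _ a] \<Gamma>])
  finally have level0: "measure_pmf.expectation (?M ?W0) g \<le> measure_pmf.expectation (?M ?W0) ?f"
    by (simp add: size_at_def)
  have mono: "strict_mono (\<lambda>t. c * \<phi> powr (- t))"
  proof (rule strict_monoI)
    fix s t :: real assume "s < t"
    then show "c * \<phi> powr (- s) < c * \<phi> powr (- t)"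
      using c \<phi> powr_less_mono'[of \<phi> "- t" "- s"] by simp
  qed
  have nonneg: "0 \<le> c * \<phi> powr (- K)" using c by simp
  note NP = finite_profiles[OF fin] equalityD1[OF support] equalityD1[OF support]
    ratio mono nonneg _ _ g level0
  show "power_at ?M g W \<le> power_at ?M ?f W"
    unfolding power_at_def
    by (rule neyman_pearson_optimal[OF NP]) (simp_all add: threshold_test_def)
  show "g P = ?f P" if "power_at ?M ?f W \<le> power_at ?M g W" "P \<in> profiles A n"
    "of_int (margin_set P B a) \<noteq> K" for P
    by (rule neyman_pearson_unique[OF NP])
      (use that in \<open>simp_all add: threshold_test_def power_at_def support\<close>)
qed

lemma threshold_test_UMP:
  assumes "finite A" "0 < \<phi>" "\<phi> < 1" "B \<subseteq> A - {a}" "a \<in> A" "H1 \<subseteq> L_above A B a" "\<Gamma> \<in> {0..1}"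
    and "size_test (mallows_model A n \<phi>) (L_top A a) (threshold_test a B K \<Gamma>) = \<alpha>"
  shows "is_UMP (profiles A n) (mallows_model A n \<phi>) \<alpha> (L_top A a) H1 (threshold_test a B K \<Gamma>)"
  unfolding is_UMP_def
proof (intro conjI ballI allI impI)
  show "is_test (profiles A n) (threshold_test a B K \<Gamma>)"
    by (rule threshold_test_is_test[OF assms(7)])
  show "size_test (mallows_model A n \<phi>) (L_top A a) (threshold_test a B K \<Gamma>) = \<alpha>"
    by (rule assms(8))
  fix W g assume W: "W \<in> H1"
    and g: "is_test (profiles A n) g \<and> size_test (mallows_model A n \<phi>) (L_top A a) g \<le> \<alpha>"
  show "power_at (mallows_model A n \<phi>) g W \<le>
      power_at (mallows_model A n \<phi>) (threshold_test a B K \<Gamma>) W"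
    by (rule threshold_test_most_powerful[OF assms(1-5) subsetD[OF assms(6) W] assms(7)])
      (use g assms(8) in simp_all)
qed

lemma UMP_eq_threshold_test:
  assumes "finite A" "0 < \<phi>" "\<phi> < 1" "B \<subseteq> A - {a}" "a \<in> A" "W \<in> L_above A B a" "W \<in> H1" "\<Gamma> \<in> {0..1}"
    and size: "size_test (mallows_model A n \<phi>) (L_top A a) (threshold_test a B K \<Gamma>) = \<alpha>"
    and f: "is_UMP (profiles A n) (mallows_model A n \<phi>) \<alpha> (L_top A a) H1 f"
    and P: "P \<in> profiles A n" "of_int (margin_set P B a) \<noteq> K"
  shows "f P = threshold_test a B K \<Gamma> P"
proof (rule threshold_test_unique[OF assms(1-6,8) _ _ _ P])
  show "is_test (profiles A n) f"
    and "size_test (mallows_model A n \<phi>) (L_top A a) f \<le>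
      size_test (mallows_model A n \<phi>) (L_top A a) (threshold_test a B K \<Gamma>)"
    using f size by (auto simp: is_UMP_def)
  show "power_at (mallows_model A n \<phi>) (threshold_test a B K \<Gamma>) W \<le>
      power_at (mallows_model A n \<phi>) f W"
    using f assms(7) threshold_test_is_test[OF assms(8), of "profiles A n" a B K] size
    unfolding is_UMP_def by simp
qed

section \<open>Hypotheses with different sets above \<open>a\<close>\<close>

text \<open>
  At the level of the test that rejects exactly if all votes put \<open>B1\<close> above \<open>a\<close>, optimality against
  \<open>W1\<close> determines the test everywhere. Optimality against \<open>W2\<close> then
  requires that no rejected profile has a smaller margin for \<open>B2\<close> than an accepted one. But if all
  votes put \<open>B1\<close> and nothing else above \<open>a\<close>, the margin of \<open>B2\<close> is at least \<open>2 * n\<close> below its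
  maximum, whereas if all votes put everything above \<open>a\<close>, except one vote that puts a single member
  of \<open>B1\<close> below, it is at most 2 below the maximum. As \<open>2 \<le> n\<close>, this is a contradiction.
\<close>

lemma no_UMP_if_not_subset:
  fixes n :: nat
  assumes fin: "finite A" and n: "2 \<le> n" and \<phi>: "0 < \<phi>" "\<phi> < 1" and a: "a \<in> A"
    and B1: "B1 \<subseteq> A - {a}" "B1 \<noteq> {}" and B2: "B2 \<subseteq> A - {a}" "\<not> B2 \<subseteq> B1"
    and W1: "W1 \<in> L_above A B1 a" "W1 \<in> H1" and W2: "W2 \<in> L_above A B2 a" "W2 \<in> H1"
  obtains \<alpha> where "0 < \<alpha>" "\<alpha> < 1"
    "\<And>f. \<not> is_UMP (profiles A n) (mallows_model A n \<phi>) \<alpha> (L_top A a) H1 f"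
proof -
  let ?M = "mallows_model A n \<phi>"
  have finB: "finite B1" "finite B2" using fin B1(1) B2(1) finite_subset by blast+
  obtain b where b: "b \<in> B1" using B1(2) by blast
  obtain U1 where U1: "U1 \<in> L_above A B1 a" using L_above_nonempty[OF B1(1) a] .
  obtain U2 where U2: "U2 \<in> L_above A (A - {a, b}) a"
    by (rule L_above_nonempty[OF _ a, of "A - {a, b}"]) auto
  obtain U3 where U3: "U3 \<in> L_above A (A - {a}) a"
    by (rule L_above_nonempty[OF _ a, of "A - {a}"]) auto
  define P where "P = replicate n U1"
  define Q where "Q = U2 # replicate (n - 1) U3"
  have PQ: "P \<in> profiles A n" "Q \<in> profiles A n"
    using U1 U2 U3 n by (auto simp: P_def Q_def profiles_def L_above_def in_lists_conv_set)
  have marginP: "margin_set P B a = int n * (2 * int (card (B \<inter> B1)) - int (card B))"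
    if "B \<subseteq> A - {a}" "finite B" for B
    using that vote_margin_L_above[OF U1 fin _ a, of B]
    by (simp add: margin_set_eq_sum_list P_def sum_list_replicate)
  have marginQ: "margin_set Q B a = int n * int (card B) - 2 * of_bool (b \<in> B)"
    if B: "B \<subseteq> A - {a}" "finite B" for B
  proof -
    have "B \<inter> (A - {a, b}) = B - {b}" "B \<inter> (A - {a}) = B" using B by auto
    moreover have "int (card (B - {b})) = int (card B) - of_bool (b \<in> B)"
      using B(2) card_Suc_Diff1[of B b] by (cases "b \<in> B") auto
    ultimately show ?thesis
      using B n vote_margin_L_above[OF U2 fin _ a, of B] vote_margin_L_above[OF U3 fin _ a, of B]
      by (simp add: margin_set_eq_sum_list Q_def sum_list_replicate of_nat_diff algebra_simps)
  qed
  \<comment> \<open>Just below the largest possible margin; not an integer, so that no profile lies on the threshold.\<close>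
  define K1 :: real where "K1 = real (n * card B1) - 1 / 2"
  define f1 where "f1 = threshold_test a B1 K1 0"
  have K1: "of_int z \<noteq> K1" for z :: int
  proof
    assume "of_int z = K1"
    then have "real_of_int (2 * z) = of_int (2 * int (n * card B1) - 1)" by (simp add: K1_def)
    then have "2 * z = 2 * int (n * card B1) - 1" by (simp only: of_int_eq_iff)
    then show False by presburger
  qed
  have f1P: "f1 P = 1" and f1Q: "f1 Q = 0"
    using marginP[OF B1(1) finB(1)] marginQ[OF B1(1) finB(1)] b
    by (simp_all add: f1_def threshold_test_def K1_def)
  define \<alpha> where "\<alpha> = size_test ?M (L_top A a) f1"
  let ?W0 = "raise A a W1"
  have W0: "?W0 \<in> L_top A a" using W1(1) a by (intro raise_in_L_top) (auto simp: L_above_def)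
  have "\<alpha> = size_at ?M f1 ?W0"
    unfolding \<alpha>_def f1_def
    by (rule size_threshold_test[OF fin \<phi> B1(1) a W0 raise_block[OF W1(1) _ _ a]]) auto
  moreover have "size_at ?M f1 ?W0 = measure_pmf.prob (?M ?W0) {P. f1 P = 1}"
  proof -
    have "f1 = indicator {P. f1 P = 1}"
      by (auto simp: f1_def threshold_test_def indicator_def fun_eq_iff)
    then have "size_at ?M f1 ?W0 = measure_pmf.expectation (?M ?W0) (indicator {P. f1 P = 1})"
      by (metis size_at_def)
    then show ?thesis by simp
  qed
  ultimately have \<alpha>: "\<alpha> = measure_pmf.prob (?M ?W0) {P. f1 P = 1}" by simp
  have support: "set_pmf (?M ?W0) = profiles A n" by (rule set_pmf_mallows_model[OF fin \<phi>(1)])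
  have "\<alpha> \<noteq> 0" using f1P PQ(1) support by (auto simp: \<alpha> measure_pmf_zero_iff)
  then have \<alpha>_pos: "0 < \<alpha>" using measure_nonneg[of "measure_pmf (?M ?W0)"] \<alpha> by (simp add: less_le)
  have "\<alpha> \<noteq> 1"
  proof
    assume "\<alpha> = 1"
    then have "AE P in ?M ?W0. P \<in> {P. f1 P = 1}"
      unfolding \<alpha> by (subst (asm) measure_pmf.prob_eq_1) auto
    then show False using f1Q PQ(2) support by (auto simp: AE_measure_pmf_iff)
  qed
  then have \<alpha>_less: "\<alpha> < 1" using measure_pmf.prob_le_1[of "?M ?W0"] \<alpha> by (simp add: less_le)
  have "\<not> is_UMP (profiles A n) ?M \<alpha> (L_top A a) H1 f" for f
  proof
    assume f: "is_UMP (profiles A n) ?M \<alpha> (L_top A a) H1 f"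
    have "f R = f1 R" if "R \<in> profiles A n" for R
      unfolding f1_def
      by (rule UMP_eq_threshold_test[OF fin \<phi> B1(1) a W1 _ _ f that K1])
        (simp_all add: \<alpha>_def f1_def)
    then have fP: "f P = 1" and fQ: "f Q = 0" using f1P f1Q PQ by auto
    obtain K2 \<Gamma> where \<Gamma>: "\<Gamma> \<in> {0..1}"
      and size: "size_test ?M (L_top A a) (threshold_test a B2 K2 \<Gamma>) = \<alpha>"
      using threshold_test_size_exists[OF fin \<phi> B2(1) a \<alpha>_pos \<alpha>_less] by blast
    note f2 = UMP_eq_threshold_test[OF fin \<phi> B2(1) a W2 \<Gamma> size f]
    have "K2 \<le> of_int (margin_set P B2 a)"
    proof (rule ccontr)
      assume "\<not> K2 \<le> of_int (margin_set P B2 a)"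
      then show False using f2[OF PQ(1)] fP by (simp add: threshold_test_def)
    qed
    moreover have "of_int (margin_set Q B2 a) \<le> K2"
    proof (rule ccontr)
      assume "\<not> of_int (margin_set Q B2 a) \<le> K2"
      then show False using f2[OF PQ(2)] fQ by (simp add: threshold_test_def)
    qed
    ultimately have le: "margin_set Q B2 a \<le> margin_set P B2 a" by linarith
    have "card (B2 \<inter> B1) < card B2" using B2(2) finB(2) by (intro psubset_card_mono) auto
    then have "2 * int (card (B2 \<inter> B1)) - int (card B2) \<le> int (card B2) - 2" by linarith
    then have "margin_set P B2 a \<le> int n * (int (card B2) - 2)"
      unfolding marginP[OF B2(1) finB(2)] by (rule mult_left_mono) simp
    also have "\<dots> < margin_set Q B2 a"
      using n by (simp add: marginQ[OF B2(1) finB(2)] algebra_simps)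
    finally show False using le by simp
  qed
  with \<alpha>_pos \<alpha>_less show thesis by (rule that)
qed

section \<open>The characterization\<close>

theorem theorem2:
  fixes A :: "'a set" and a :: 'a and n :: nat and \<phi> :: real and H1 :: "'a rel set"
  assumes "finite A" and "2 \<le> card A" and "2 \<le> n" and "0 < \<phi>" and "\<phi> < 1"
    and "a \<in> A" and "H1 \<subseteq> rankings A - L_top A a"
  shows
    "((\<forall>\<alpha>. 0 < \<alpha> \<and> \<alpha> < 1 \<longrightarrow>
         (\<exists>f. is_UMP (profiles A n) (mallows_model A n \<phi>) \<alpha> (L_top A a) H1 f))
      \<longleftrightarrow> (\<exists>B. B \<subseteq> A - {a} \<and> H1 \<subseteq> L_above A B a)) \<and>
     (\<forall>B \<alpha>. B \<subseteq> A - {a} \<and> H1 \<subseteq> L_above A B a \<and> 0 < \<alpha> \<and> \<alpha> < 1 \<longrightarrow>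
         (\<exists>K. \<exists>\<Gamma>\<in>{0..1}.
            size_test (mallows_model A n \<phi>) (L_top A a) (threshold_test a B K \<Gamma>) = \<alpha>) \<and>
         (\<forall>K. \<forall>\<Gamma>\<in>{0..1}.
            size_test (mallows_model A n \<phi>) (L_top A a) (threshold_test a B K \<Gamma>) = \<alpha> \<longrightarrow>
            is_UMP (profiles A n) (mallows_model A n \<phi>) \<alpha> (L_top A a) H1
              (threshold_test a B K \<Gamma>)))"
proof -
  let ?M = "mallows_model A n \<phi>"
  let ?UMP = "\<lambda>\<alpha>. is_UMP (profiles A n) ?M \<alpha> (L_top A a) H1"
  have sufficient: "(\<exists>K. \<exists>\<Gamma>\<in>{0..1}. size_test ?M (L_top A a) (threshold_test a B K \<Gamma>) = \<alpha>) \<and>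
      (\<forall>K. \<forall>\<Gamma>\<in>{0..1}. size_test ?M (L_top A a) (threshold_test a B K \<Gamma>) = \<alpha> \<longrightarrow>
        ?UMP \<alpha> (threshold_test a B K \<Gamma>))"
    if "B \<subseteq> A - {a}" "H1 \<subseteq> L_above A B a" "0 < \<alpha>" "\<alpha> < 1" for B \<alpha>
    using threshold_test_size_exists[OF assms(1,4,5) that(1) assms(6) that(3,4)]
      threshold_test_UMP[OF assms(1,4,5) that(1) assms(6) that(2)] by blast
  have "\<exists>B. B \<subseteq> A - {a} \<and> H1 \<subseteq> L_above A B a"
    if ump: "\<forall>\<alpha>. 0 < \<alpha> \<and> \<alpha> < 1 \<longrightarrow> (\<exists>f. ?UMP \<alpha> f)"
  proof (cases "H1 = {}")
    case False
    define up where "up = (\<lambda>W. {b \<in> A. b \<succ>\<^bsub>W\<^esub> a})"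
    have up: "up W \<subseteq> A - {a}" for W by (auto simp: up_def prefers_def)
    have above: "W \<in> L_above A (up W) a" and nonempty: "up W \<noteq> {}" if "W \<in> H1" for W
    proof -
      have W: "W \<in> rankings A" "W \<notin> L_top A a" using that assms(7) by auto
      then show "W \<in> L_above A (up W) a" by (simp add: L_above_def up_def)
      obtain b where "b \<in> A" "b \<noteq> a" "\<not> a \<succ>\<^bsub>W\<^esub> b" using W by (auto simp: L_top_def)
      then show "up W \<noteq> {}" using not_prefers_iff[OF W(1) assms(6), of b] by (auto simp: up_def)
    qed
    have sub: "up W2 \<subseteq> up W1" if W: "W1 \<in> H1" "W2 \<in> H1" for W1 W2
    proof (rule ccontr)
      assume "\<not> up W2 \<subseteq> up W1"
      then obtain \<alpha> where "0 < \<alpha>" "\<alpha> < 1" "\<And>f. \<not> ?UMP \<alpha> f"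
        using no_UMP_if_not_subset[OF assms(1,3-6) up nonempty[OF W(1)] up _
            above[OF W(1)] W(1) above[OF W(2)] W(2)] by blast
      then show False using ump by blast
    qed
    have same: "up W2 = up W1" if "W1 \<in> H1" "W2 \<in> H1" for W1 W2
      using sub[OF that] sub[OF that(2,1)] by (rule equalityI)
    obtain W where "W \<in> H1" using False by blast
    have "H1 \<subseteq> L_above A (up W) a"
    proof
      fix U assume "U \<in> H1"
      then show "U \<in> L_above A (up W) a" using above[of U] same[OF \<open>W \<in> H1\<close>, of U] by simp
    qed
    then show ?thesis using up by blast
  qed auto
  moreover have "\<exists>f. ?UMP \<alpha> f"
    if "\<exists>B. B \<subseteq> A - {a} \<and> H1 \<subseteq> L_above A B a" "0 < \<alpha>" "\<alpha> < 1" for \<alpha>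
  proof -
    from that(1) obtain B where B: "B \<subseteq> A - {a}" "H1 \<subseteq> L_above A B a" by blast
    show ?thesis using sufficient[OF B that(2,3)] by blast
  qed
  ultimately show ?thesis using sufficient by blast
qed

end
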